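(* Let $G$ be a group and let $V$ be a non-zero vector space over a field $\mathbb{K}$. Suppose that every surjective linear cellular automaton $\tau \colon V^G \to V^G$ is injective. Then $G$ is periodic.
   Context: A group is called periodic if all its elements have finite order. Let $G$ be a group and $A$ a set. $A^G$ denotes the set of all maps $x \colon G \to A$ (configurations). The group $G$ acts on $A^G$ by $(gx)(h) = x(g^{-1}h)$ for all $x \in A^G$ and $g,h \in G$. A cellular automaton over the group $G$ and the alphabet $A$ is a map $\tau \colon A^G \to A^G$ for which there exist a finite subset $M \subset G$ (a memory set) and a map $\mu \colon A^M \to A$ (a local defining map) such that $\tau(x)(g) = \mu((g^{-1}x)|_M)$ for all $x \in A^G$ and $g \in G$, where $(\cdot)|_M \colon A^G \to A^M$ is the restriction map. If $V$ is a vector space over a field $\mathbb{K}$, a cellular automaton $\tau \colon V^G \to V^G$ is called a linear cellular automaton if $\tau$ is $\mathbb{K}$-linear with respect to the product (pointwise) vector space structure on $V^G$. The vector space $V$ is not assumed to be finite-dimensional. *)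

theory Defs
  imports "HOL-Algebra.Algebra"
begin

(* By group.ord_eq_0, the order of an element is 0 exactly when no positive power of it
   is the identity. *)
definition periodic_group :: "('g, 'm) monoid_scheme \<Rightarrow> bool" where
  "periodic_group G \<longleftrightarrow> group G \<and> (\<forall>g \<in> carrier G. group.ord G g \<noteq> 0)"

definition configurations :: "('g, 'm) monoid_scheme \<Rightarrow> 'a set \<Rightarrow> ('g \<Rightarrow> 'a) set" where
  "configurations G A = carrier G \<rightarrow>\<^sub>E A"

definition shift :: "('g, 'm) monoid_scheme \<Rightarrow> 'g \<Rightarrow> ('g \<Rightarrow> 'a) \<Rightarrow> 'g \<Rightarrow> 'a" where
  "shift G g x = (\<lambda>h \<in> carrier G. x (inv\<^bsub>G\<^esub> g \<otimes>\<^bsub>G\<^esub> h))"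

(* Only the values of tau on configurations G A matter; tau is arbitrary elsewhere.
   Likewise for mu outside of A^M, which is M \<rightarrow>\<^sub>E A. *)
definition cellular_automaton ::
    "('g, 'm) monoid_scheme \<Rightarrow> 'a set \<Rightarrow> (('g \<Rightarrow> 'a) \<Rightarrow> ('g \<Rightarrow> 'a)) \<Rightarrow> bool" where
  "cellular_automaton G A \<tau> \<longleftrightarrow>
     \<tau> \<in> configurations G A \<rightarrow> configurations G A \<and>
     (\<exists>M \<mu>. finite M \<and> M \<subseteq> carrier G \<and> \<mu> \<in> (M \<rightarrow>\<^sub>E A) \<rightarrow> A \<and>
        (\<forall>x \<in> configurations G A. \<forall>g \<in> carrier G.
           \<tau> x g = \<mu> (restrict (shift G (inv\<^bsub>G\<^esub> g) x) M)))"

(* The multiplicative fields that the module record inherits from rings play no role in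
   the locale module, so they are left unspecified. *)
definition configuration_space ::
    "('g, 'm) monoid_scheme \<Rightarrow> ('k, 'v, 'n) module_scheme \<Rightarrow> ('k, 'g \<Rightarrow> 'v) module" where
  "configuration_space G V =
     \<lparr>carrier = configurations G (carrier V),
      monoid.mult = undefined, one = undefined,
      ring.zero = (\<lambda>h \<in> carrier G. \<zero>\<^bsub>V\<^esub>),
      ring.add = (\<lambda>x y. \<lambda>h \<in> carrier G. x h \<oplus>\<^bsub>V\<^esub> y h),
      module.smult = (\<lambda>a x. \<lambda>h \<in> carrier G. a \<odot>\<^bsub>V\<^esub> x h)\<rparr>"

lemma module_configuration_space:
  assumes "Module.module K V"
  shows "Module.module K (configuration_space G V)"
proof -
  interpret Module.module K V by fact
  show ?thesis
  proof (rule moduleI)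
    show "abelian_group (configuration_space G V)"
    proof (rule abelian_groupI)
      fix x assume x: "x \<in> carrier (configuration_space G V)"
      show "\<exists>y \<in> carrier (configuration_space G V).
          y \<oplus>\<^bsub>configuration_space G V\<^esub> x = \<zero>\<^bsub>configuration_space G V\<^esub>"
        using x
        by (intro bexI[of _ "\<lambda>h \<in> carrier G. \<ominus>\<^bsub>V\<^esub> x h"])
           (auto simp: configuration_space_def configurations_def PiE_iff M.l_neg
                 intro!: restrict_ext)
    qed (auto simp: configuration_space_def configurations_def PiE_iff M.a_ac fun_eq_iff
                    extensional_def)
  qed (auto simp: configuration_space_def configurations_def PiE_iff fun_eq_iff extensional_def
                  smult_l_distr smult_r_distr smult_assoc1 intro: R.is_cring)
qed

definition linear_map ::
    "('k, 'm) ring_scheme \<Rightarrow> ('k, 'v, 'n) module_scheme \<Rightarrow> ('k, 'w, 'p) module_scheme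
       \<Rightarrow> ('v \<Rightarrow> 'w) \<Rightarrow> bool" where
  "linear_map K V W f \<longleftrightarrow>
     f \<in> carrier V \<rightarrow> carrier W \<and>
     (\<forall>x \<in> carrier V. \<forall>y \<in> carrier V. f (x \<oplus>\<^bsub>V\<^esub> y) = f x \<oplus>\<^bsub>W\<^esub> f y) \<and>
     (\<forall>a \<in> carrier K. \<forall>x \<in> carrier V. f (a \<odot>\<^bsub>V\<^esub> x) = a \<odot>\<^bsub>W\<^esub> f x)"

definition linear_cellular_automaton ::
    "('g, 'l) monoid_scheme \<Rightarrow> ('k, 'm) ring_scheme \<Rightarrow> ('k, 'v, 'n) module_scheme
       \<Rightarrow> (('g \<Rightarrow> 'v) \<Rightarrow> ('g \<Rightarrow> 'v)) \<Rightarrow> bool" where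
  "linear_cellular_automaton G K V \<tau> \<longleftrightarrow>
     cellular_automaton G (carrier V) \<tau> \<and>
     linear_map K (configuration_space G V) (configuration_space G V) \<tau>"

end

theory Submission
  imports Defs
begin

text \<open>If \<open>g\<close> has infinite order, the difference operator \<open>\<tau>(x)(h) = x(hg) - x(h)\<close> is a linear
  cellular automaton with memory set \<open>{1, g}\<close>. It kills all constant configurations, so it is not
  injective. It is surjective because every left coset of the subgroup generated by \<open>g\<close> is a copy
  of the integers, on which a difference equation is solved by summation.\<close>

text \<open>Summing \<open>f\<close> from the base point 0, forwards and backwards, solves the
  equation. It serves along one coset, with \<open>f\<close> the values of the target configuration
  there.\<close>

lemma (in abelian_group) int_difference_equation_solvable:
  fixes f :: "int \<Rightarrow> 'a"
  assumes f: "\<And>n. f n \<in> carrier G"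
  shows "\<exists>F. (\<forall>n. F n \<in> carrier G) \<and> (\<forall>n. F (n + 1) = F n \<oplus> f n)"
proof (intro exI conjI allI)
  \<comment> \<open>At most one of the two intervals is nonempty, so one formula covers both signs
    of \<open>n\<close>; it takes the value zero at 0.\<close>
  let ?F = "\<lambda>n. (\<Oplus>i\<in>{0..<n}. f i) \<ominus> (\<Oplus>i\<in>{n..<0}. f i)"
  have cl: "(\<Oplus>i\<in>A. f i) \<in> carrier G" for A :: "int set"
    using f by (intro finsum_closed) auto
  fix n :: int
  show "?F n \<in> carrier G" using cl by simp
  show "?F (n + 1) = ?F n \<oplus> f n"
  proof (cases "n \<ge> 0")
    case True
    then have "{0..<n + 1} = insert n {0..<n}" by auto
    then have "(\<Oplus>i\<in>{0..<n + 1}. f i) = f n \<oplus> (\<Oplus>i\<in>{0..<n}. f i)"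
      using f by (simp add: finsum_insert)
    then show ?thesis using True f cl[of "{0..<n}"] by (simp add: minus_eq a_ac)
  next
    case False
    then have "{n..<0} = insert n {n + 1..<0}" by auto
    then have eq: "(\<Oplus>i\<in>{n..<0}. f i) = f n \<oplus> (\<Oplus>i\<in>{n + 1..<0}. f i)"
      using f by (simp add: finsum_insert)
    \<comment> \<open>Here n + 1 \<le> 0, so both sums over nonnegative indices are empty. The claim
      reduces to this identity with \<open>a\<close> = \<open>f n\<close> and \<open>b\<close> the
      sum over \<open>{n + 1..<0}\<close>.\<close>
    have "\<ominus> b = \<ominus> (a \<oplus> b) \<oplus> a" if "a \<in> carrier G" "b \<in> carrier G" for a b
      using that by (simp add: minus_add a_ac r_neg2)
    then show ?thesis using False f cl[of "{n + 1..<0}"] by (simp add: eq minus_eq)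
  qed
qed

text \<open>Two powers agree exactly when the order divides the difference of the exponents, and 0
  divides only 0.\<close>

lemma (in group) inj_int_pow_if_ord_eq_0:
  assumes "g \<in> carrier G" and "ord g = 0"
  shows "inj (\<lambda>n::int. g [^] n)"
  using assms by (auto intro!: injI simp: int_pow_eq)

text \<open>\<open>r\<close> picks a representative of each left coset of the subgroup generated by
  \<open>g\<close>, and \<open>e\<close> is the position relative to it. Right multiplication by
  \<open>g\<close> stays in the coset and moves one position; infinite order makes positions
  unique.\<close>

lemma (in group) coset_coordinates:
  assumes g: "g \<in> carrier G" and ord: "ord g = 0"
  obtains r :: "'a \<Rightarrow> 'a" and e :: "'a \<Rightarrow> int"
  where "\<And>h. h \<in> carrier G \<Longrightarrow> r h \<in> carrier G"
    and "\<And>h. h \<in> carrier G \<Longrightarrow> h = r h \<otimes> g [^] e h"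
    and "\<And>h. h \<in> carrier G \<Longrightarrow> r (h \<otimes> g) = r h"
    and "\<And>h. h \<in> carrier G \<Longrightarrow> e (h \<otimes> g) = e h + 1"
proof -
  define orb where "orb h = range (\<lambda>n::int. h \<otimes> g [^] n)" for h
  \<comment> \<open>The choice depends only on the set \<open>orb h\<close>, a left coset for
    \<open>h\<close> in the group, so \<open>r\<close> is constant on cosets.\<close>
  define r where "r h = (SOME k. k \<in> orb h)" for h
  define e where "e h = (SOME n::int. h = r h \<otimes> g [^] n)" for h
  have step: "h \<otimes> g \<otimes> g [^] n = h \<otimes> g [^] (n + 1)" if "h \<in> carrier G" for h and n :: int
    using that g int_pow_mult[of g 1 n] by (simp add: m_assoc add.commute)
  have orb_step: "orb (h \<otimes> g) = orb h" if "h \<in> carrier G" for h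
  proof -
    \<comment> \<open>Multiplying by \<open>g\<close> only reindexes the orbit along n \<mapsto> n +
      1, a bijection of the integers.\<close>
    have "orb (h \<otimes> g) = (\<lambda>n. h \<otimes> g [^] n) ` range (\<lambda>n::int. n + 1)"
      unfolding orb_def image_image using step[OF that] by (simp only:)
    then show ?thesis by (simp add: orb_def)
  qed
  have r_orb: "r h \<in> orb h" for h
    unfolding r_def by (rule someI[of _ "h \<otimes> g [^] (0::int)"]) (unfold orb_def, rule rangeI)
  have r_closed: "r h \<in> carrier G" if "h \<in> carrier G" for h
    using r_orb[of h] that g by (auto simp: orb_def)
  have e: "h = r h \<otimes> g [^] e h" if h: "h \<in> carrier G" for h
  proof -
    obtain n :: int where "r h = h \<otimes> g [^] n" using r_orb[of h] by (auto simp: orb_def)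
    then have "h = r h \<otimes> g [^] (- n)"
      using h g by (simp add: m_assoc flip: int_pow_mult)
    then show ?thesis unfolding e_def by (rule someI)
  qed
  have r_step: "r (h \<otimes> g) = r h" if "h \<in> carrier G" for h
    using orb_step[OF that] by (simp add: r_def)
  have "e (h \<otimes> g) = e h + 1" if h: "h \<in> carrier G" for h
  proof -
    \<comment> \<open>Both \<open>h\<close> and \<open>h \<otimes> g\<close> have the representative
      \<open>r h\<close>. Writing \<open>h \<otimes> g\<close> in two ways and cancelling
      \<open>r h\<close> leaves two powers of \<open>g\<close> to compare.\<close>
    have "r h \<otimes> g [^] e (h \<otimes> g) = h \<otimes> g"
      using e[of "h \<otimes> g"] h g r_step by simp
    also have "\<dots> = r h \<otimes> g [^] e h \<otimes> g" using e[OF h] by simp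
    also have "\<dots> = r h \<otimes> g [^] (e h + 1)"
      using r_closed[OF h] g by (simp add: m_assoc int_pow_mult)
    finally have "g [^] e (h \<otimes> g) = g [^] (e h + 1)"
      using r_closed[OF h] g by simp
    then show ?thesis using inj_int_pow_if_ord_eq_0[OF g ord] by (simp add: inj_eq)
  qed
  with r_closed e r_step show thesis using that by blast
qed

lemma restrict_mem_configurations:
  "(\<And>h. h \<in> carrier G \<Longrightarrow> f h \<in> A) \<Longrightarrow> restrict f (carrier G) \<in> configurations G A"
  by (simp add: configurations_def)

lemma configurations_apply:
  "x \<in> configurations G A \<Longrightarrow> h \<in> carrier G \<Longrightarrow> x h \<in> A"
  by (auto simp: configurations_def)

lemma configurations_eqI:
  "x \<in> configurations G A \<Longrightarrow> y \<in> configurations G A \<Longrightarrow>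
    (\<And>h. h \<in> carrier G \<Longrightarrow> x h = y h) \<Longrightarrow> x = y"
  unfolding configurations_def by (rule PiE_ext)

text \<open>Translating by \<open>g\<close> on the right commutes with the shift action, which
  multiplies on the left.\<close>

definition difference_operator ::
    "('g, 'l) monoid_scheme \<Rightarrow> ('k, 'v, 'n) module_scheme \<Rightarrow> 'g \<Rightarrow> ('g \<Rightarrow> 'v) \<Rightarrow> 'g \<Rightarrow> 'v" where
  "difference_operator G V g x = (\<lambda>h \<in> carrier G. x (h \<otimes>\<^bsub>G\<^esub> g) \<ominus>\<^bsub>V\<^esub> x h)"

lemma linear_cellular_automaton_difference_operator:
  assumes "group G" and "Module.module K V" and g: "g \<in> carrier G"
  shows "linear_cellular_automaton G K V (difference_operator G V g)"
proof -
  interpret G: group G by fact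
  interpret V: Module.module K V by fact
  let ?C = "configurations G (carrier V)" and ?\<tau> = "difference_operator G V g"
  have maps: "?\<tau> x \<in> ?C" if "x \<in> ?C" for x
    unfolding difference_operator_def
    using that g by (intro restrict_mem_configurations) (simp add: configurations_apply)
  have "cellular_automaton G (carrier V) ?\<tau>"
    unfolding cellular_automaton_def
  \<comment> \<open>The configuration \<open>x\<close> shifted by the inverse of \<open>h\<close>
    takes the values of \<open>x\<close> at \<open>h\<close> and \<open>h \<otimes> g\<close> on the
    two memory points, and the local rule subtracts them.\<close>
  proof (intro conjI exI[of _ "{\<one>\<^bsub>G\<^esub>, g}"] exI[of _ "\<lambda>y. y g \<ominus>\<^bsub>V\<^esub> y \<one>\<^bsub>G\<^esub>"] ballI)
    show "(\<lambda>y. y g \<ominus>\<^bsub>V\<^esub> y \<one>\<^bsub>G\<^esub>) \<in> ({\<one>\<^bsub>G\<^esub>, g} \<rightarrow>\<^sub>E carrier V) \<rightarrow> carrier V"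
      by (auto simp: PiE_iff)
  qed (use maps g in \<open>auto simp: difference_operator_def shift_def\<close>)
  moreover have "linear_map K (configuration_space G V) (configuration_space G V) ?\<tau>"
    unfolding linear_map_def
  proof (intro conjI ballI)
    show "?\<tau> \<in> carrier (configuration_space G V) \<rightarrow> carrier (configuration_space G V)"
      using maps by (simp add: configuration_space_def)
  next
    have *: "(a \<oplus>\<^bsub>V\<^esub> b) \<ominus>\<^bsub>V\<^esub> (c \<oplus>\<^bsub>V\<^esub> d) = (a \<ominus>\<^bsub>V\<^esub> c) \<oplus>\<^bsub>V\<^esub> (b \<ominus>\<^bsub>V\<^esub> d)"
      if "a \<in> carrier V" "b \<in> carrier V" "c \<in> carrier V" "d \<in> carrier V" for a b c d
      using that by (simp add: V.M.minus_eq V.M.minus_add V.M.a_ac)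
    fix x y
    assume "x \<in> carrier (configuration_space G V)" "y \<in> carrier (configuration_space G V)"
    then show "?\<tau> (x \<oplus>\<^bsub>configuration_space G V\<^esub> y) = ?\<tau> x \<oplus>\<^bsub>configuration_space G V\<^esub> ?\<tau> y"
      using g by (auto simp: configuration_space_def difference_operator_def configurations_apply
          * intro!: restrict_ext)
  next
    fix a x
    assume "a \<in> carrier K" "x \<in> carrier (configuration_space G V)"
    then show "?\<tau> (a \<odot>\<^bsub>configuration_space G V\<^esub> x) = a \<odot>\<^bsub>configuration_space G V\<^esub> ?\<tau> x"
      using g by (auto simp: configuration_space_def difference_operator_def configurations_apply
          V.M.minus_eq V.smult_r_distr V.smult_r_minus intro!: restrict_ext)
  qed
  ultimately show ?thesis by (simp add: linear_cellular_automaton_def)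
qed

text \<open>In the coordinates of a coset, a preimage of \<open>z\<close> is a solution of a
  first-order difference equation on the integers. Distinct cosets do not interact, so the solutions
  can be chosen independently and glued.\<close>

lemma difference_operator_surj:
  assumes "group G" and "Module.module K V" and g: "g \<in> carrier G" and ord: "group.ord G g = 0"
  shows "difference_operator G V g ` configurations G (carrier V) = configurations G (carrier V)"
    (is "?\<tau> ` ?C = ?C")
proof
  interpret G: group G by fact
  interpret V: Module.module K V by fact
  have maps: "?\<tau> x \<in> ?C" if "x \<in> ?C" for x
    unfolding difference_operator_def
    using that g by (intro restrict_mem_configurations) (simp add: configurations_apply)
  then show "?\<tau> ` ?C \<subseteq> ?C" by blast
  obtain r and e :: "_ \<Rightarrow> int" where r: "\<And>h. h \<in> carrier G \<Longrightarrow> r h \<in> carrier G"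
    and e: "\<And>h. h \<in> carrier G \<Longrightarrow> h = r h \<otimes>\<^bsub>G\<^esub> g [^]\<^bsub>G\<^esub> e h"
    and r_step: "\<And>h. h \<in> carrier G \<Longrightarrow> r (h \<otimes>\<^bsub>G\<^esub> g) = r h"
    and e_step: "\<And>h. h \<in> carrier G \<Longrightarrow> e (h \<otimes>\<^bsub>G\<^esub> g) = e h + 1"
    using G.coset_coordinates[OF g ord] by blast
  show "?C \<subseteq> ?\<tau> ` ?C"
  proof
    fix z assume z: "z \<in> ?C"
    have "\<exists>F. (\<forall>n::int. F n \<in> carrier V) \<and>
        (\<forall>n. F (n + 1) = F n \<oplus>\<^bsub>V\<^esub> z (k \<otimes>\<^bsub>G\<^esub> g [^]\<^bsub>G\<^esub> n))"
      if "k \<in> carrier G" for k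
      using that g z
      by (intro V.M.int_difference_equation_solvable) (simp add: configurations_apply)
    then obtain F :: "_ \<Rightarrow> int \<Rightarrow> _" where
      F: "\<And>k n. k \<in> carrier G \<Longrightarrow> F k n \<in> carrier V"
      and F_step: "\<And>k n. k \<in> carrier G \<Longrightarrow>
        F k (n + 1) = F k n \<oplus>\<^bsub>V\<^esub> z (k \<otimes>\<^bsub>G\<^esub> g [^]\<^bsub>G\<^esub> n)"
      by metis
    \<comment> \<open>Only the solutions \<open>F k\<close> with \<open>k\<close> a chosen
      representative are used, so each coset is filled from a single solution.\<close>
    define x where "x = (\<lambda>h \<in> carrier G. F (r h) (e h))"
    have x: "x \<in> ?C"
      unfolding x_def using F r by (intro restrict_mem_configurations) simp
    have "?\<tau> x = z"
    proof (rule configurations_eqI[OF maps[OF x] z])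
      fix h assume h: "h \<in> carrier G"
      have "x (h \<otimes>\<^bsub>G\<^esub> g) = F (r h) (e h + 1)"
        using h g by (simp add: x_def r_step e_step)
      \<comment> \<open>The increment supplied by \<open>F_step\<close> is \<open>z\<close> at
        \<open>r h \<otimes> g [^] e h\<close>, which is the point \<open>h\<close> itself.\<close>
      also have "\<dots> = x h \<oplus>\<^bsub>V\<^esub> z h"
        using h r e[OF h] by (simp add: x_def F_step)
      finally have "?\<tau> x h = (x h \<oplus>\<^bsub>V\<^esub> z h) \<ominus>\<^bsub>V\<^esub> x h"
        using h by (simp add: difference_operator_def)
      also have "\<dots> = z h"
        using configurations_apply[OF x h] configurations_apply[OF z h]
        by (simp add: V.M.minus_eq V.M.a_comm V.M.r_neg1 V.M.r_neg2 V.M.a_assoc)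
      finally show "?\<tau> x h = z h" .
    qed
    with x show "z \<in> ?\<tau> ` ?C" by blast
  qed
qed

lemma difference_operator_not_inj:
  assumes "group G" and "Module.module K V" and g: "g \<in> carrier G"
    and nonzero: "carrier V \<noteq> {\<zero>\<^bsub>V\<^esub>}"
  shows "\<not> inj_on (difference_operator G V g) (configurations G (carrier V))"
proof
  interpret G: group G by fact
  interpret V: Module.module K V by fact
  let ?c = "\<lambda>v. \<lambda>h \<in> carrier G. v"
  assume inj: "inj_on (difference_operator G V g) (configurations G (carrier V))"
  obtain v where v: "v \<in> carrier V" "v \<noteq> \<zero>\<^bsub>V\<^esub>" using nonzero V.M.zero_closed by blast
  \<comment> \<open>Both sides are the zero configuration, since constants have zero
    differences.\<close>
  have "difference_operator G V g (?c v) = difference_operator G V g (?c \<zero>\<^bsub>V\<^esub>)"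
    using v g by (auto simp: difference_operator_def V.M.minus_eq V.M.r_neg intro!: restrict_ext)
  then have "?c v = ?c \<zero>\<^bsub>V\<^esub>"
    by (rule inj_onD[OF inj]) (use v in \<open>simp_all add: restrict_mem_configurations\<close>)
  then have "?c v \<one>\<^bsub>G\<^esub> = ?c \<zero>\<^bsub>V\<^esub> \<one>\<^bsub>G\<^esub>" by (rule fun_cong)
  with v show False by simp
qed

theorem corollary4p2:
  fixes G :: "('g, 'l) monoid_scheme"
    and K :: "('k, 'm) ring_scheme"
    and V :: "('k, 'v, 'n) module_scheme"
  assumes "group G"
    and "Ring.field K"
    and "Module.module K V"
    and "carrier V \<noteq> {\<zero>\<^bsub>V\<^esub>}"
    and "\<And>\<tau>. linear_cellular_automaton G K V \<tau> \<Longrightarrow>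
           \<tau> ` configurations G (carrier V) = configurations G (carrier V) \<Longrightarrow>
           inj_on \<tau> (configurations G (carrier V))"
  shows "periodic_group G"
  unfolding periodic_group_def
proof (intro conjI ballI notI)
  show "group G" by fact
  fix g assume g: "g \<in> carrier G" and ord: "group.ord G g = 0"
  \<comment> \<open>An element of infinite order makes the difference operator surjective, so the
    hypothesis forces it to be injective, although it identifies all constants.\<close>
  have "inj_on (difference_operator G V g) (configurations G (carrier V))"
    using linear_cellular_automaton_difference_operator[OF assms(1,3) g]
      difference_operator_surj[OF assms(1,3) g ord] by (rule assms(5))
  with difference_operator_not_inj[OF assms(1,3) g assms(4)] show False by blast
qed

end
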